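(* Let $S=\{i_1<i_2<\dots<i_s\}$ be a finite set of positive integers. If $i_{r+1}-i_r$ is odd for some $1\le r\le s-1$, then $0,1,2,\dots,i_r$ are roots of the peak polynomial $p_S(x)$.
   Context: For a permutation $\pi=\pi_1\cdots\pi_n\in\mathfrak S_n$, an index $1<i<n$ is a peak if $\pi_{i-1}<\pi_i>\pi_{i+1}$; $P(\pi)$ is the set of peaks of $\pi$, and $\mathcal P_S(n)=\{\pi\in\mathfrak S_n: P(\pi)=S\}$. A finite set $S$ of positive integers is admissible if $\mathcal P_S(n)\neq\emptyset$ for some $n$; equivalently $1\notin S$ and $S$ contains no two consecutive integers. Known fact (Billey–Burdzy–Sagan): for a nonempty admissible $S$ with $m=\max(S)$ there is a unique polynomial $p_S(x)$, of degree $m-1$ and integer-valued on integers, such that $|\mathcal P_S(n)|=p_S(n)2^{n-|S|-1}$ for all $n\ge m$; for $S=\emptyset$, $|\mathcal P_\emptyset(n)|=2^{n-1}$ and $p_\emptyset(x)=1$. If $S$ is not admissible, $p_S(x)=0$ (the zero polynomial). $p_S$ is called the peak polynomial of $S$. *)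

theory Defs
  imports
    "HOL-Combinatorics.Permutations"
    "HOL-Computational_Algebra.Polynomial"
begin

definition peaks :: "nat \<Rightarrow> (nat \<Rightarrow> nat) \<Rightarrow> nat set" where
  "peaks n \<pi> = {i. 1 < i \<and> i < n \<and> \<pi> (i - 1) < \<pi> i \<and> \<pi> i > \<pi> (i + 1)}"

definition perms_with_peak_set :: "nat set \<Rightarrow> nat \<Rightarrow> (nat \<Rightarrow> nat) set" where
  "perms_with_peak_set S n = {\<pi>. \<pi> permutes {1..n} \<and> peaks n \<pi> = S}"

definition admissible :: "nat set \<Rightarrow> bool" where
  "admissible S \<longleftrightarrow> (\<exists>n. perms_with_peak_set S n \<noteq> {})"

(* The peak polynomial is integer-valued on the integers, so its coefficients are rational.
   The counting identity at infinitely many n already determines it; its degree (Max S - 1)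
   is a consequence and not part of the definition.  The exponent n - card S - 1 is never
   truncated: an admissible S has no two consecutive elements and does not contain 1, so
   card S < Max S \<le> n. *)
definition peak_polynomial :: "nat set \<Rightarrow> rat poly" where
  "peak_polynomial S =
     (if \<not> admissible S then 0
      else if S = {} then 1
      else (THE p. \<forall>n \<ge> Max S.
              of_nat (card (perms_with_peak_set S n)) = poly p (of_nat n) * 2 ^ (n - card S - 1)))"

end

theory Submission
  imports Defs "HOL-Combinatorics.Multiset_Permutations"
begin

text \<open>Cut a permutation after position \<open>j\<close>. If the prefix has peak set \<open>T \<subseteq> {..<j}\<close> and the suffix has no
  peak, the whole has peak set \<open>T\<close>, \<open>T \<union> {j}\<close> or \<open>T \<union> {j + 1}\<close>. Counting both sides gives
  \<open>p(T \<union> {j+1})(x) = p(T)(j) (x choose j) - 2 p(T)(x) - p(T \<union> {j})(x)\<close>, whose binomial term vanishes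
  at \<open>x = 0, ..., j - 1\<close>. Moving the last peak away from the previous one \<open>l\<close> one step at a time,
  the values at \<open>k \<le> l\<close> therefore alternate between \<open>0\<close> (odd gap; gap 1 is not admissible) and
  \<open>-2 p(T)(k)\<close> (even gap). Any later peaks are removed by the same recurrence.\<close>

section \<open>Peaks of lists and arrangements of a finite set\<close>

text \<open>Positions count from 1 as in \<open>peaks\<close>, while list indices count from 0, so
  the entry at position \<open>i\<close> is \<open>xs ! (i - 1)\<close>. The guard
  \<open>1 < i\<close> keeps \<open>i - 2\<close> from truncating.\<close>

definition list_peaks :: "nat list \<Rightarrow> nat set" where
  "list_peaks xs = {i. 1 < i \<and> i < length xs \<and> xs ! (i - 2) < xs ! (i - 1) \<and> xs ! i < xs ! (i - 1)}"

text \<open>The values range over an arbitrary finite set because a cut permutation leaves two lists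
  over complementary subsets of \<open>{1..n}\<close>.\<close>

definition arrangements :: "nat set \<Rightarrow> nat set \<Rightarrow> nat list set" where
  "arrangements S X = {xs \<in> permutations_of_set X. list_peaks xs = S}"

lemma finite_arrangements [simp]: "finite (arrangements S X)"
  unfolding arrangements_def by simp

lemma length_permutations_of_set:
  "xs \<in> permutations_of_set X \<Longrightarrow> length xs = card X"
  by (auto simp: permutations_of_set_def distinct_card)

lemma list_peaks_map:
  assumes "strict_mono_on (set xs) h"
  shows "list_peaks (map h xs) = list_peaks xs"
  using assms
  by (auto simp: list_peaks_def strict_mono_on_less)

lemma card_arrangements_image:
  assumes "finite X" "strict_mono_on X h"
  shows "card (arrangements S (h ` X)) = card (arrangements S X)"
proof -
  have inj: "inj_on h X" using assms(2) by (rule strict_mono_on_imp_inj_on)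
  have "arrangements S (h ` X) = map h ` arrangements S X"
  proof -
    have "permutations_of_set (h ` X) = map h ` permutations_of_set X"
      using permutations_of_set_image_inj[OF inj] .
    moreover have "list_peaks (map h xs) = list_peaks xs" if "xs \<in> permutations_of_set X" for xs
      using that assms(2) by (intro list_peaks_map) (auto simp: permutations_of_set_def)
    ultimately show ?thesis by (auto simp: arrangements_def)
  qed
  moreover have "inj_on (map h) (arrangements S X)"
    by (rule inj_onI, rule map_inj_on)
      (use inj in \<open>auto simp: arrangements_def permutations_of_set_def\<close>)
  ultimately show ?thesis by (simp add: card_image)
qed

text \<open>Peaks depend only on the relative order of the entries, so the increasing enumeration of
  a set lets it be replaced by an initial segment of the same size.\<close>

lemma card_arrangements_cong:
  assumes "finite X" "finite Y" "card X = card Y"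
  shows "card (arrangements S X) = card (arrangements S Y)"
proof -
  have key: "card (arrangements S Z) = card (arrangements S {..<card Z})" if "finite Z" for Z :: "nat set"
  proof -
    let ?e = "\<lambda>i. sorted_list_of_set Z ! i"
    have len: "length (sorted_list_of_set Z) = card Z" by simp
    have "strict_mono_on {..<card Z} ?e"
      by (intro strict_mono_onI sorted_wrt_nth_less[OF strict_sorted_list_of_set]) simp_all
    moreover have "?e ` {..<card Z} = Z"
      using that nth_image[of "card Z" "sorted_list_of_set Z"] by (simp add: lessThan_atLeast0)
    ultimately show ?thesis using card_arrangements_image[of "{..<card Z}" ?e S] by simp
  qed
  show ?thesis using key[OF assms(1)] key[OF assms(2)] assms(3) by simp
qed

text \<open>Passing to one-line notation, the map \<open>F\<close>, is a bijection that preserves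
  peaks.\<close>

lemma card_perms_with_peak_set:
  "card (perms_with_peak_set S n) = card (arrangements S {1..n})"
proof -
  define F where "F = (\<lambda>\<pi>::nat \<Rightarrow> nat. map \<pi> [1..<Suc n])"
  have len: "length (F \<pi>) = n" and nth: "i < n \<Longrightarrow> F \<pi> ! i = \<pi> (Suc i)" for \<pi> i
    by (simp_all add: F_def del: upt_Suc)
  have peaks: "list_peaks (F \<pi>) = peaks n \<pi>" for \<pi>
  proof -
    have "F \<pi> ! (i - 2) = \<pi> (i - 1)" "F \<pi> ! (i - 1) = \<pi> i" "F \<pi> ! i = \<pi> (i + 1)"
      if "1 < i" "i < n" for i
    proof -
      have *: "Suc (i - 2) = i - 1" "Suc (i - 1) = i" "i - 2 < n" "i - 1 < n" using that by simp_all
      then show "F \<pi> ! (i - 2) = \<pi> (i - 1)" "F \<pi> ! (i - 1) = \<pi> i" "F \<pi> ! i = \<pi> (i + 1)"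
        using nth[of "i - 2" \<pi>] nth[of "i - 1" \<pi>] nth[of i \<pi>] that
        unfolding * by simp_all
    qed
    then show ?thesis by (auto simp: list_peaks_def peaks_def len)
  qed
  have mem: "F \<pi> \<in> permutations_of_set {1..n}" if "\<pi> permutes {1..n}" for \<pi>
    using that unfolding F_def permutations_of_set_def
    by (simp add: distinct_map permutes_inj_on permutes_image atLeastLessThanSuc_atLeastAtMost del: upt_Suc)
  have inj: "inj_on F {\<pi>. \<pi> permutes {1..n}}"
  proof (rule inj_onI, rule ext)
    fix \<pi> \<sigma> x assume *: "\<pi> \<in> {\<pi>. \<pi> permutes {1..n}}" "\<sigma> \<in> {\<pi>. \<pi> permutes {1..n}}" "F \<pi> = F \<sigma>"
    show "\<pi> x = \<sigma> x"
    proof (cases "x \<in> {1..n}")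
      case True
      then have "x - 1 < n" "Suc (x - 1) = x" by auto
      then show ?thesis using nth[of "x - 1" \<pi>] nth[of "x - 1" \<sigma>] *(3) by simp
    next
      case False
      then show ?thesis using * by (simp add: permutes_not_in)
    qed
  qed
  \<comment> \<open>Surjectivity comes from counting: both sides have \<open>fact n\<close>
    elements.\<close>
  have "F ` {\<pi>. \<pi> permutes {1..n}} = permutations_of_set {1..n}"
  proof (rule card_subset_eq)
    show "card (F ` {\<pi>. \<pi> permutes {1..n}}) = card (permutations_of_set {1..n})"
      by (subst card_image[OF inj]) (simp add: card_permutations)
  qed (use mem in auto)
  moreover have "F ` perms_with_peak_set S n = {xs \<in> F ` {\<pi>. \<pi> permutes {1..n}}. list_peaks xs = S}"
    unfolding perms_with_peak_set_def peaks[symmetric] by blast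
  ultimately have "F ` perms_with_peak_set S n = arrangements S {1..n}"
    by (simp only: arrangements_def)
  moreover have "inj_on F (perms_with_peak_set S n)"
    by (rule inj_on_subset[OF inj]) (auto simp: perms_with_peak_set_def)
  ultimately show ?thesis by (metis card_image)
qed

section \<open>Cutting a list into a prefix and a suffix\<close>

lemma list_peaks_take:
  "j \<le> length xs \<Longrightarrow> list_peaks (take j xs) = list_peaks xs \<inter> {..<j}"
  by (auto simp: list_peaks_def)

lemma list_peaks_drop:
  "j \<le> length xs \<Longrightarrow> list_peaks (drop j xs) = {i. 1 < i \<and> i + j \<in> list_peaks xs}"
  by (auto simp: list_peaks_def add.commute)

lemma list_peaks_not_consecutive: "i \<in> list_peaks xs \<Longrightarrow> Suc i \<notin> list_peaks xs"
  by (auto simp: list_peaks_def)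

text \<open>Position \<open>Suc j\<close> becomes the first entry of the suffix, so a peak there,
  like any earlier one, is invisible in \<open>drop j xs\<close>.\<close>

lemma list_peaks_drop_empty_iff:
  "j \<le> length xs \<Longrightarrow> list_peaks (drop j xs) = {} \<longleftrightarrow> list_peaks xs \<subseteq> {..Suc j}"
proof
  assume j: "j \<le> length xs" and e: "list_peaks (drop j xs) = {}"
  show "list_peaks xs \<subseteq> {..Suc j}"
  proof
    fix i assume "i \<in> list_peaks xs"
    then have "\<not> (1 < i - j \<and> i - j + j \<in> list_peaks xs)"
      using e unfolding list_peaks_drop[OF j] by blast
    with \<open>i \<in> list_peaks xs\<close> show "i \<in> {..Suc j}" by (cases "j \<le> i") auto
  qed
qed (auto simp: list_peaks_drop)

text \<open>The only peaks that neither piece shows are those at \<open>j\<close> and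
  \<open>Suc j\<close>, the two sides of the cut. Adjacent positions are never both peaks, which
  leaves three cases.\<close>

lemma arrangements_cut:
  assumes "j < card X" and "S \<subseteq> {..<j}"
  shows "{xs \<in> permutations_of_set X. list_peaks (take j xs) = S \<and> list_peaks (drop j xs) = {}}
    = arrangements S X \<union> arrangements (insert j S) X \<union> arrangements (insert (Suc j) S) X" (is "?L = ?R")
proof -
  have "list_peaks (take j xs) = S \<and> list_peaks (drop j xs) = {} \<longleftrightarrow>
     list_peaks xs = S \<or> list_peaks xs = insert j S \<or> list_peaks xs = insert (Suc j) S"
    if "xs \<in> permutations_of_set X" for xs
  proof -
    define Q where "Q = list_peaks xs"
    have j: "j \<le> length xs" using assms(1) that by (simp add: length_permutations_of_set)
    have nc: "\<not> (j \<in> Q \<and> Suc j \<in> Q)" using list_peaks_not_consecutive by (auto simp: Q_def)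
    have "Q \<inter> {..<j} = S \<and> Q \<subseteq> {..Suc j} \<longleftrightarrow> Q = S \<or> Q = insert j S \<or> Q = insert (Suc j) S"
      (is "?A \<longleftrightarrow> ?B")
    proof
      assume ?A
      have "{..Suc j} = {..<j} \<union> {j, Suc j}" by auto
      then show ?B using \<open>?A\<close> nc by blast
    next
      assume ?B
      then show ?A using assms(2) by (elim disjE) auto
    qed
    then show ?thesis by (simp add: list_peaks_take[OF j] list_peaks_drop_empty_iff[OF j] Q_def)
  qed
  then show ?thesis unfolding arrangements_def by blast
qed

text \<open>Once the set \<open>A\<close> of values in the prefix is chosen, the two pieces vary
  independently, and their counts depend only on the sizes. \<open>Y\<close> and \<open>Z\<close>
  are arbitrary representatives of these sizes.\<close>

lemma card_cut:
  assumes "finite X" "j \<le> card X" "finite Y" "card Y = j" "finite Z" "card Z = card X - j"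
  shows "card {xs \<in> permutations_of_set X. list_peaks (take j xs) = S \<and> list_peaks (drop j xs) = T}
    = (card X choose j) * card (arrangements S Y) * card (arrangements T Z)" (is "card ?L = _")
proof -
  let ?B = "{A. A \<subseteq> X \<and> card A = j}"
  let ?D = "SIGMA A:?B. arrangements S A \<times> arrangements T (X - A)"
  let ?f = "\<lambda>(A::nat set, ys::nat list, zs). ys @ zs"
  have "bij_betw ?f ?D ?L"
  proof (rule bij_betw_byWitness[where f' = "\<lambda>xs. (set (take j xs), take j xs, drop j xs)"])
    show "\<forall>a\<in>?D. (\<lambda>xs. (set (take j xs), take j xs, drop j xs)) (?f a) = a"
      by (auto simp: arrangements_def length_permutations_of_set)
         (auto simp: permutations_of_set_def)
    show "\<forall>xs\<in>?L. ?f (set (take j xs), take j xs, drop j xs) = xs" by auto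
    show "?f ` ?D \<subseteq> ?L"
      by (auto simp: arrangements_def length_permutations_of_set)
         (auto simp: permutations_of_set_def)
    show "(\<lambda>xs. (set (take j xs), take j xs, drop j xs)) ` ?L \<subseteq> ?D"
    proof (clarify, intro SigmaI conjI CollectI)
      fix xs assume xs: "xs \<in> permutations_of_set X"
      from xs have d: "distinct xs" "set xs = X" by (auto simp: permutations_of_set_def)
      then show "set (take j xs) \<subseteq> X" by (auto dest: in_set_takeD)
      have l: "length xs = card X" using xs by (rule length_permutations_of_set)
      then show "card (set (take j xs)) = j" using d assms(2) by (simp add: distinct_card)
      show "take j xs \<in> arrangements (list_peaks (take j xs)) (set (take j xs))"
        using d by (auto simp: arrangements_def permutations_of_set_def)
      have "distinct (take j xs @ drop j xs)" "set (take j xs @ drop j xs) = X"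
        using d by simp_all
      then have "set (drop j xs) = X - set (take j xs)"
        unfolding distinct_append set_append by blast
      then show "drop j xs \<in> arrangements (list_peaks (drop j xs)) (X - set (take j xs))"
        using d by (auto simp: arrangements_def permutations_of_set_def)
    qed
  qed
  then have "card ?L = card ?D" by (simp add: bij_betw_same_card)
  also have "\<dots> = (\<Sum>A\<in>?B. card (arrangements S A) * card (arrangements T (X - A)))"
    using assms(1) by (subst card_SigmaI) (auto simp: card_cartesian_product)
  also have "\<dots> = (\<Sum>A\<in>?B. card (arrangements S Y) * card (arrangements T Z))"
  proof (intro sum.cong refl arg_cong2[where f = "(*)"])
    fix A assume A: "A \<in> ?B"
    then have "finite A" using assms(1) finite_subset by auto
    then show "card (arrangements S A) = card (arrangements S Y)"
      using A assms by (intro card_arrangements_cong) auto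
    show "card (arrangements T (X - A)) = card (arrangements T Z)"
      using A \<open>finite A\<close> assms by (intro card_arrangements_cong) (auto simp: card_Diff_subset)
  qed
  also have "\<dots> = (card X choose j) * card (arrangements S Y) * card (arrangements T Z)"
    using assms(1) by (simp add: n_subsets)
  finally show ?thesis .
qed

section \<open>Arrangements without peaks\<close>

lemma list_peaks_Cons_Max:
  assumes "\<And>y. y \<in> set ys \<Longrightarrow> y < M" "list_peaks ys = {}"
  shows "list_peaks (M # ys) = {}"
proof -
  have "i \<notin> list_peaks (M # ys)" for i
  proof
    assume i: "i \<in> list_peaks (M # ys)"
    then have b: "1 < i" "i \<le> length ys" by (auto simp: list_peaks_def)
    show False
    proof (cases "i = 2")
      case True
      then have "M < ys ! 0" "ys \<noteq> []" using i by (auto simp: list_peaks_def)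
      then show False using assms(1)[of "ys ! 0"] by auto
    next
      case False
      \<comment> \<open>From position 3 on, the three entries compared all lie in \<open>ys\<close>,
        one position earlier.\<close>
      then have "i = Suc (Suc (Suc (i - 3)))" using b by simp
      then obtain k where k: "i = Suc (Suc (Suc k))" ..
      then have "Suc (Suc k) \<in> list_peaks ys" using i by (auto simp: list_peaks_def)
      then show False using assms(2) by simp
    qed
  qed
  then show ?thesis by blast
qed

lemma list_peaks_snoc_Max:
  assumes "\<And>y. y \<in> set ys \<Longrightarrow> y < M" "list_peaks ys = {}"
  shows "list_peaks (ys @ [M]) = {}"
proof -
  have "i \<notin> list_peaks (ys @ [M])" for i
  proof
    assume i: "i \<in> list_peaks (ys @ [M])"
    then have b: "1 < i" "i \<le> length ys" by (auto simp: list_peaks_def)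
    show False
    proof (cases "i = length ys")
      \<comment> \<open>Only at this position is \<open>M\<close> the right neighbour, and the peak
        would have to exceed it.\<close>
      case True
      then have "M < ys ! (i - 1)" "i - 1 < length ys"
        using i b by (auto simp: list_peaks_def nth_append split: if_splits)
      then show False using assms(1)[of "ys ! (i - 1)"] by auto
    next
      case False
      then have "i \<in> list_peaks ys" using i b by (auto simp: list_peaks_def nth_append split: if_splits)
      then show False using assms(2) by simp
    qed
  qed
  then show ?thesis by blast
qed

text \<open>A maximum in the interior of a list would be a peak, so it sits at one of the two ends.\<close>

lemma arrangements_empty_insert_Max:
  assumes "finite X" "\<And>x. x \<in> X \<Longrightarrow> x < M"
  shows "arrangements {} (insert M X) = (#) M ` arrangements {} X \<union> (\<lambda>ys. ys @ [M]) ` arrangements {} X"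
    (is "?L = ?R")
proof
  have M: "M \<notin> X" using assms(2) by blast
  show "?R \<subseteq> ?L"
    using M assms(2) list_peaks_Cons_Max list_peaks_snoc_Max
    by (auto simp: arrangements_def permutations_of_set_def)
  show "?L \<subseteq> ?R"
  proof
    fix xs assume "xs \<in> ?L"
    then have xs: "set xs = insert M X" "distinct xs" and np: "list_peaks xs = {}"
      by (auto simp: arrangements_def permutations_of_set_def)
    then obtain as bs where eq: "xs = as @ M # bs" by (metis insertI1 split_list)
    have set: "set as \<union> set bs = X" "distinct (as @ bs)" using xs M unfolding eq by auto
    have "as = [] \<or> bs = []"
    proof (rule ccontr)
      assume ne: "\<not> (as = [] \<or> bs = [])"
      then obtain a as' b bs' where ab: "as = as' @ [a]" "bs = b # bs'"
        by (metis neq_Nil_conv rev_exhaust)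
      then have "a < M" "b < M" using set assms(2) by auto
      then have "Suc (Suc (length as')) \<in> list_peaks xs"
        unfolding eq ab by (simp add: list_peaks_def nth_append)
      then show False using np by simp
    qed
    then show "xs \<in> ?R"
    proof
      assume "as = []"
      moreover from this have "list_peaks bs = {}"
        using np list_peaks_drop[of 1 xs] by (simp add: eq)
      ultimately show ?thesis using set eq
        by (auto simp: arrangements_def permutations_of_set_def)
    next
      assume "bs = []"
      moreover from this have "list_peaks as = {}"
        using np list_peaks_take[of "length as" xs] by (simp add: eq)
      ultimately show ?thesis using set eq
        by (auto simp: arrangements_def permutations_of_set_def)
    qed
  qed
qed

text \<open>Each new maximum goes to either end and doubles the count. The factor 2 on the left
  avoids the exponent \<open>card X - 1\<close>.\<close>

lemma card_arrangements_empty: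
  assumes "finite X" "X \<noteq> {}"
  shows "2 * card (arrangements {} X) = 2 ^ card X"
  using assms
proof (induction X rule: finite_linorder_max_induct)
  case empty
  then show ?case by simp
next
  case (insert M X)
  show ?case
  proof (cases "X = {}")
    case True
    have "arrangements {} {M} = {[M]}"
      by (auto simp: arrangements_def list_peaks_def)
    with True show ?thesis by simp
  next
    case False
    have M: "M \<notin> X" using insert.hyps(2) by blast
    \<comment> \<open>The two ends give different lists because \<open>X\<close> is nonempty: one
      starts with \<open>M\<close>, the other with an element of \<open>X\<close>. Over a singleton
      they coincide, hence the separate case above.\<close>
    have "(#) M ` arrangements {} X \<inter> (\<lambda>ys. ys @ [M]) ` arrangements {} X = {}"
    proof -
      have "M # ys \<noteq> zs @ [M]" if "ys \<in> arrangements {} X" "zs \<in> arrangements {} X" for ys zs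
        using that False M by (cases zs) (auto simp: arrangements_def permutations_of_set_def)
      then show ?thesis by blast
    qed
    then have "card (arrangements {} (insert M X)) = 2 * card (arrangements {} X)"
      using insert.hyps
      by (subst arrangements_empty_insert_Max) (auto simp: card_Un_disjoint card_image inj_on_def)
    then show ?thesis using insert False M by simp
  qed
qed

section \<open>The recurrence for counts and for polynomials\<close>

text \<open>Lists whose cut at \<open>j\<close> has prefix peaks \<open>S\<close> and a peak-free
  suffix are counted in two ways, by \<open>arrangements_cut\<close> and by \<open>card_cut\<close>.
  The factor 2 completes the peak-free suffix count to \<open>2 ^ (n - j)\<close>.\<close>

lemma peak_count_recurrence:
  assumes "1 \<le> j" "j < n" "S \<subseteq> {..<j}"
  shows "2 * (card (perms_with_peak_set S n) + card (perms_with_peak_set (insert j S) n)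
      + card (perms_with_peak_set (insert (Suc j) S) n))
    = (n choose j) * card (perms_with_peak_set S j) * 2 ^ (n - j)"
proof -
  have ne: "S \<noteq> insert j S" "S \<noteq> insert (Suc j) S" "insert j S \<noteq> insert (Suc j) S"
    using assms(3) by auto
  let ?X = "{1..n}"
  have "card (arrangements S ?X) + card (arrangements (insert j S) ?X) + card (arrangements (insert (Suc j) S) ?X)
    = card (arrangements S ?X \<union> arrangements (insert j S) ?X \<union> arrangements (insert (Suc j) S) ?X)"
    using ne by (subst card_Un_disjoint; (subst card_Un_disjoint)?) (auto simp: arrangements_def)
  also have "\<dots> = (n choose j) * card (arrangements S {1..j}) * card (arrangements {} {1..n-j})"
    using arrangements_cut[of j ?X S] card_cut[of ?X j "{1..j}" "{1..n-j}" S "{}"] assms by simp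
  finally show ?thesis
    using card_arrangements_empty[of "{1..n-j}"] assms
    by (simp add: card_perms_with_peak_set)
qed

text \<open>The defining identity with denominators cleared, so that no exponent is truncated; it
  makes sense for every finite set, admissible or not.\<close>

definition counts_peaks :: "nat set \<Rightarrow> rat poly \<Rightarrow> bool" where
  "counts_peaks S p \<longleftrightarrow> (\<forall>n\<ge>1. S \<subseteq> {..n} \<longrightarrow>
     of_nat (card (perms_with_peak_set S n)) * 2 ^ Suc (card S) = poly p (of_nat n) * 2 ^ n)"

lemma counts_peaks_unique:
  assumes "finite S" "counts_peaks S p" "counts_peaks S q"
  shows "p = q"
proof (rule ccontr)
  assume "p \<noteq> q"
  then have fin: "finite {x. poly (p - q) x = 0}" by (intro poly_roots_finite) simp
  obtain N where N: "S \<subseteq> {..N}" using assms(1) finite_nat_iff_bounded_le by blast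
  \<comment> \<open>The counting identity fixes the value at every n beyond \<open>N\<close>, so the
    difference has infinitely many roots.\<close>
  have "of_nat ` {Suc N..} \<subseteq> {x. poly (p - q) x = 0}"
  proof clarify
    fix n assume n: "Suc N \<le> n"
    then have "S \<subseteq> {..n}" using N by auto
    then have "poly p (of_nat n) * 2 ^ n = poly q (of_nat n) * 2 ^ n"
      using n assms(2,3) unfolding counts_peaks_def by (metis le_add1 le_trans plus_1_eq_Suc)
    then show "poly (p - q) (of_nat n) = 0" by simp
  qed
  then have "finite (of_nat ` {Suc N..} :: rat set)" using fin finite_subset by blast
  then have "finite {Suc N..}" by (rule finite_imageD) (simp add: inj_on_def)
  then show False by (simp add: infinite_Ici)
qed

lemma counts_peaks_not_admissible: "\<not> admissible S \<Longrightarrow> counts_peaks S 0"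
  by (simp add: counts_peaks_def admissible_def)

lemma counts_peaks_empty: "counts_peaks {} 1"
  unfolding counts_peaks_def
proof (intro allI impI)
  fix n :: nat assume "1 \<le> n"
  then have "2 * card (perms_with_peak_set {} n) = 2 ^ n"
    using card_arrangements_empty[of "{1..n}"] by (simp add: card_perms_with_peak_set)
  then have "of_nat (2 * card (perms_with_peak_set {} n)) = (of_nat (2 ^ n) :: rat)" by (rule arg_cong)
  then show "of_nat (card (perms_with_peak_set {} n)) * 2 ^ Suc (card {}) = poly 1 (of_nat n) * (2::rat) ^ n"
    by simp
qed

definition binomial_poly :: "nat \<Rightarrow> rat poly" where
  "binomial_poly j = smult (1 / fact j) (\<Prod>i=0..<j. [:- of_nat i, 1:])"

lemma poly_binomial_poly: "poly (binomial_poly j) (of_nat n) = of_nat (n choose j)"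
  by (simp add: binomial_poly_def poly_prod binomial_gbinomial gbinomial_prod_rev)

lemma counts_peaks_recurrence:
  assumes "1 \<le> j" "S \<subseteq> {..<j}" "counts_peaks S p" "counts_peaks (insert j S) q"
  shows "counts_peaks (insert (Suc j) S)
    (smult (poly p (of_nat j)) (binomial_poly j) - smult 2 p - q)"
  unfolding counts_peaks_def
proof (intro allI impI)
  fix n assume n: "1 \<le> n" "insert (Suc j) S \<subseteq> {..n}"
  have fin: "finite S" using assms(2) finite_subset by blast
  define c where "c = card S"
  have card: "card (insert j S) = Suc c" "card (insert (Suc j) S) = Suc c"
    using assms(2) fin by (auto simp: c_def card_insert_if)
  define a b d e where "a = (of_nat (card (perms_with_peak_set S n)) :: rat)"
    and "b = (of_nat (card (perms_with_peak_set (insert j S) n)) :: rat)"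
    and "d = (of_nat (card (perms_with_peak_set (insert (Suc j) S) n)) :: rat)"
    and "e = (of_nat (card (perms_with_peak_set S j)) :: rat)"
  have "of_nat (2 * (card (perms_with_peak_set S n) + card (perms_with_peak_set (insert j S) n)
      + card (perms_with_peak_set (insert (Suc j) S) n)))
    = (of_nat ((n choose j) * card (perms_with_peak_set S j) * 2 ^ (n - j)) :: rat)"
    \<comment> \<open>Since \<open>Suc j\<close> lies in \<open>{..n}\<close>, the cut satisfies
      \<open>j < n\<close>.\<close>
    using peak_count_recurrence[of j n S] assms n by simp
  then have rec: "2 * (a + b + d) = of_nat (n choose j) * e * 2 ^ (n - j)"
    by (simp add: a_def b_def d_def e_def)
  have A: "a * 2 ^ Suc c = poly p (of_nat n) * 2 ^ n"
    using assms(3) n unfolding counts_peaks_def a_def c_def by auto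
  have B: "b * 2 ^ Suc (Suc c) = poly q (of_nat n) * 2 ^ n"
    using assms(4) n card unfolding counts_peaks_def b_def by auto
  \<comment> \<open>The identity for \<open>S\<close> is used a second time, at length
    \<open>j\<close>; this turns the prefix count into the constant
    \<open>poly p (of_nat j)\<close>.\<close>
  have E: "e * 2 ^ Suc c = poly p (of_nat j) * 2 ^ j"
  proof -
    have "S \<subseteq> {..j}" using assms(2) by auto
    then show ?thesis using assms(1,3) unfolding counts_peaks_def e_def c_def by blast
  qed
  have pow: "(2::rat) ^ n = 2 ^ j * 2 ^ (n - j)"
    using n by (simp flip: power_add)
  have "d * 2 ^ Suc (Suc c) = of_nat (n choose j) * (e * 2 ^ Suc c) * 2 ^ (n - j)
      - 2 * (a * 2 ^ Suc c) - b * 2 ^ Suc (Suc c)"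
    using arg_cong[OF rec, of "\<lambda>x. x * 2 ^ Suc c"] by (simp add: algebra_simps)
  also have "\<dots> = (poly p (of_nat j) * of_nat (n choose j) - 2 * poly p (of_nat n) - poly q (of_nat n)) * 2 ^ n"
    unfolding A B E by (simp add: algebra_simps pow)
  finally show "of_nat (card (perms_with_peak_set (insert (Suc j) S) n)) * 2 ^ Suc (card (insert (Suc j) S))
     = poly (smult (poly p (of_nat j)) (binomial_poly j) - smult 2 p - q) (of_nat n) * 2 ^ n"
    by (simp add: d_def card poly_binomial_poly del: power_Suc)
qed

section \<open>Admissible sets and existence of the peak polynomial\<close>

lemma admissible_gt_1: "admissible S \<Longrightarrow> x \<in> S \<Longrightarrow> 1 < x"
  by (auto simp: admissible_def perms_with_peak_set_def peaks_def)

lemma admissible_not_consecutive: "admissible S \<Longrightarrow> x \<in> S \<Longrightarrow> Suc x \<notin> S"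
  by (auto simp: admissible_def perms_with_peak_set_def peaks_def)

text \<open>Splitting off the last peak \<open>Suc j\<close> gives the shape required by the
  recurrence: \<open>j\<close> itself is not a peak, so the other peaks lie below
  \<open>j\<close>.\<close>

lemma admissible_cases:
  assumes "finite S" "S \<noteq> {}" "admissible S"
  obtains T j where "S = insert (Suc j) T" "T \<subseteq> {..<j}" "1 \<le> j" "Max S = Suc j"
proof -
  have M: "Max S \<in> S" using assms by simp
  then have "1 < Max S" using assms(3) admissible_gt_1 by blast
  then obtain j where j: "Max S = Suc j" "1 \<le> j" by (cases "Max S") auto
  have "j \<notin> S" using admissible_not_consecutive[OF assms(3), of j] M j by auto
  have "x < j" if "x \<in> S - {Suc j}" for x
  proof -
    have "x \<le> Suc j" "x \<noteq> Suc j" "x \<noteq> j"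
      using that \<open>j \<notin> S\<close> Max_ge[OF assms(1), of x] j by auto
    then show ?thesis by simp
  qed
  then show ?thesis using that[of j "S - {Suc j}"] M j by auto
qed

lemma counts_peaks_exists:
  assumes "finite S" "S \<subseteq> {..<m}"
  shows "\<exists>p. counts_peaks S p"
  using assms
proof (induction m arbitrary: S)
  case 0
  then show ?case using counts_peaks_empty by auto
next
  case (Suc m)
  show ?case
  proof (cases "admissible S \<and> S \<noteq> {}")
    case False
    then show ?thesis using counts_peaks_empty counts_peaks_not_admissible by blast
  next
    case True
    then have "S \<noteq> {}" "admissible S" by simp_all
    with Suc.prems(1) obtain T j where T: "S = insert (Suc j) T" "T \<subseteq> {..<j}" "1 \<le> j" "Max S = Suc j"
      by (rule admissible_cases)
    \<comment> \<open>Replacing \<open>Suc j\<close> by \<open>j\<close> keeps the cardinality but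
      lowers the maximum, hence the induction on the bound \<open>m\<close>.\<close>
    have "finite T" "T \<subseteq> {..<m}" "insert j T \<subseteq> {..<m}"
      using T Suc.prems finite_subset by auto
    then obtain p q where "counts_peaks T p" "counts_peaks (insert j T) q"
      using Suc.IH by (metis finite_insert)
    then show ?thesis using counts_peaks_recurrence T by blast
  qed
qed

lemma counts_peaks_iff:
  assumes "finite S" "S \<noteq> {}" "admissible S"
  shows "counts_peaks S p \<longleftrightarrow> (\<forall>n \<ge> Max S.
    of_nat (card (perms_with_peak_set S n)) = poly p (of_nat n) * 2 ^ (n - card S - 1))"
proof -
  have M: "Max S \<in> S" using assms by simp
  have gt: "1 < Max S" using assms admissible_gt_1 M by blast
  \<comment> \<open>Peaks start at 2, so \<open>card S < Max S\<close> and the exponent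
    \<open>n - card S - 1\<close> is a true difference.\<close>
  have "S \<subseteq> {2..Max S}" using assms admissible_gt_1[OF assms(3)] by (auto simp: Suc_leI numeral_2_eq_2)
  then have card: "Suc (card S) \<le> Max S"
    using card_mono[of "{2..Max S}" S] gt by simp
  have sub: "1 \<le> n \<and> S \<subseteq> {..n} \<longleftrightarrow> Max S \<le> n" for n
  proof
    assume "1 \<le> n \<and> S \<subseteq> {..n}"
    then show "Max S \<le> n" using M by auto
  next
    assume "Max S \<le> n"
    then show "1 \<le> n \<and> S \<subseteq> {..n}" using gt Max_ge[OF assms(1)] by fastforce
  qed
  have "of_nat (card (perms_with_peak_set S n)) * 2 ^ Suc (card S) = poly p (of_nat n) * 2 ^ n \<longleftrightarrow>
    of_nat (card (perms_with_peak_set S n)) = poly p (of_nat n) * 2 ^ (n - card S - 1)"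
    if "Max S \<le> n" for n
  proof -
    have "(2::rat) ^ n = 2 ^ (n - card S - 1) * 2 ^ Suc (card S)"
      unfolding power_add[symmetric] using that card by (intro arg_cong[of _ _ "(^) 2"]) linarith
    then show ?thesis by (simp add: mult.assoc[symmetric] del: power_Suc)
  qed
  then show ?thesis unfolding counts_peaks_def by (metis sub)
qed

text \<open>The default values 0 and 1 satisfy the counting identity as well, so the recurrence can
  be applied without asking whether its sets are admissible or empty.\<close>

lemma counts_peaks_peak_polynomial:
  assumes "finite S"
  shows "counts_peaks S (peak_polynomial S)"
proof (cases "admissible S \<and> S \<noteq> {}")
  case False
  then show ?thesis using counts_peaks_empty counts_peaks_not_admissible
    by (auto simp: peak_polynomial_def)
next
  case True
  then have "peak_polynomial S = (THE p. counts_peaks S p)"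
    using counts_peaks_iff[OF assms] by (simp add: peak_polynomial_def)
  moreover obtain m where "S \<subseteq> {..<m}" using assms finite_nat_iff_bounded by blast
  then obtain p where p: "counts_peaks S p" using counts_peaks_exists[OF assms] by blast
  have "counts_peaks S (THE p. counts_peaks S p)"
    using p by (rule theI) (rule counts_peaks_unique[OF assms _ p])
  ultimately show ?thesis by simp
qed

section \<open>Values of peak polynomials at small arguments\<close>

lemma peak_polynomial_recurrence:
  assumes "1 \<le> j" "S \<subseteq> {..<j}" "k < j"
  shows "poly (peak_polynomial (insert (Suc j) S)) (of_nat k)
    = - 2 * poly (peak_polynomial S) (of_nat k) - poly (peak_polynomial (insert j S)) (of_nat k)"
proof -
  have "finite S" using assms(2) finite_subset by blast
  then have "peak_polynomial (insert (Suc j) S) =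
    smult (poly (peak_polynomial S) (of_nat j)) (binomial_poly j) - smult 2 (peak_polynomial S)
      - peak_polynomial (insert j S)"
    by (intro counts_peaks_unique[OF _ counts_peaks_peak_polynomial]
        counts_peaks_recurrence[OF assms(1,2)] counts_peaks_peak_polynomial) simp_all
  then show ?thesis using assms(3) by (simp add: poly_binomial_poly)
qed

lemma peak_polynomial_consecutive:
  "x \<in> S \<Longrightarrow> Suc x \<in> S \<Longrightarrow> peak_polynomial S = 0"
  using admissible_not_consecutive by (auto simp: peak_polynomial_def)

text \<open>The last gap is \<open>Suc d\<close>, so even \<open>d\<close> means an odd gap. Each
  unit step replaces a value v by \<open>- 2 * poly (peak_polynomial T) (of_nat k)\<close> minus v,
  which alternates between the two cases.\<close>

lemma peak_polynomial_last_gap: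
  assumes "T \<subseteq> {..l}" "l \<in> T" "k \<le> l"
  shows "poly (peak_polynomial (insert (Suc (l + d)) T)) (of_nat k)
    = (if even d then 0 else - 2 * poly (peak_polynomial T) (of_nat k))"
proof (induction d)
  \<comment> \<open>Gap 1 puts \<open>l\<close> and \<open>Suc l\<close> into the set, so the
    polynomial is zero.\<close>
  case 0
  then show ?case using assms peak_polynomial_consecutive[of l] by simp
next
  case (Suc d)
  have "T \<subseteq> {..<Suc (l + d)}" using assms(1) by auto
  then show ?case using peak_polynomial_recurrence[of "Suc (l + d)" T k] Suc assms by simp
qed

text \<open>If \<open>u\<close> is the last peak, \<open>peak_polynomial_last_gap\<close> applies.
  Otherwise the recurrence removes or lowers the last peak, and both resulting sets keep the gap
  from \<open>l\<close> to \<open>u\<close>.\<close>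

lemma peak_polynomial_odd_gap:
  assumes "finite S" "S \<subseteq> {..<m}" "l \<in> S" "u \<in> S" "l < u" "odd (u - l)"
    and "S \<inter> {l<..<u} = {}" "k \<le> l"
  shows "poly (peak_polynomial S) (of_nat k) = 0"
  using assms(1-4,7)
proof (induction m arbitrary: S)
  case 0
  then show ?case by simp
next
  case (Suc m)
  show ?case
  proof (cases "admissible S")
    case False
    then show ?thesis by (simp add: peak_polynomial_def)
  next
    case True
    have "S \<noteq> {}" using Suc.prems(3) by blast
    with Suc.prems(1) obtain T j where T: "S = insert (Suc j) T" "T \<subseteq> {..<j}" "1 \<le> j" "Max S = Suc j"
      using True by (rule admissible_cases)
    have "finite T" using T(2) finite_subset by blast
    have uj: "u \<le> Suc j" using Max_ge[OF Suc.prems(1) Suc.prems(4)] T(4) by simp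
    have lT: "l \<in> T" using Suc.prems(3) T(1) uj assms(5) by auto
    then have "l < j" using T(2) by auto
    show ?thesis
    proof (cases "u = Suc j")
      case True
      have "T \<subseteq> {..l}"
      proof
        fix x assume "x \<in> T"
        then have "x \<in> S" "x < u" using T True by auto
        then show "x \<in> {..l}" using Suc.prems(5) by (cases "x \<le> l") auto
      qed
      moreover have "u = Suc (l + (j - l))" "even (j - l)"
        using True \<open>l < j\<close> assms(6) by (auto simp: Suc_diff_le)
      ultimately show ?thesis
        using peak_polynomial_last_gap[of T l k "j - l"] lT assms(8) T(1) True by simp
    next
      case False
      then have uT: "u \<in> T" using Suc.prems(4) T(1) by auto
      then have "u < j" using T(2) by auto
      have "poly (peak_polynomial T) (of_nat k) = 0"
        using Suc.prems T \<open>finite T\<close> lT uT by (intro Suc.IH) auto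
      \<comment> \<open>As \<open>u < j\<close>, the inserted element does not fall between
        \<open>l\<close> and \<open>u\<close>.\<close>
      moreover have "poly (peak_polynomial (insert j T)) (of_nat k) = 0"
        using Suc.prems T \<open>finite T\<close> lT uT \<open>u < j\<close> by (intro Suc.IH) auto
      ultimately show ?thesis
        using peak_polynomial_recurrence[OF T(3,2), of k] T(1) \<open>l < j\<close> assms(8) by simp
    qed
  qed
qed

theorem corollary1p3:
  fixes S :: "nat set" and i :: "nat \<Rightarrow> nat" and s r :: nat
  assumes "finite S" and "\<forall>x\<in>S. x > 0"
    and "strict_mono_on {1..s} i" and "S = i ` {1..s}"
    and "1 \<le> r" and "r \<le> s - 1"
    and "odd (i (r + 1) - i r)"
  shows "\<forall>k\<in>{0..i r}. poly (peak_polynomial S) (of_nat k) = 0"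
proof
  fix k assume k: "k \<in> {0..i r}"
  have r: "r \<in> {1..s}" "r + 1 \<in> {1..s}" using assms(5,6) by auto
  obtain m where m: "S \<subseteq> {..<m}" using assms(1) finite_nat_iff_bounded by blast
  \<comment> \<open>Strict monotonicity makes \<open>i r\<close> and \<open>i (r + 1)\<close>
    neighbours in \<open>S\<close>: an element between them would have an index strictly between
    \<open>r\<close> and \<open>r + 1\<close>.\<close>
  have "S \<inter> {i r<..<i (r + 1)} = {}"
  proof -
    have False if "t \<in> {1..s}" "i r < i t" "i t < i (r + 1)" for t
    proof -
      have "r < t" "t < r + 1"
        using that r strict_mono_on_less[OF assms(3)] by blast+
      then show ?thesis by simp
    qed
    then show ?thesis unfolding assms(4) greaterThanLessThan_iff disjoint_iff by blast
  qed
  moreover have "i r < i (r + 1)" using r strict_mono_onD[OF assms(3)] by simp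
  ultimately show "poly (peak_polynomial S) (of_nat k) = 0"
    using peak_polynomial_odd_gap[OF assms(1) m, of "i r" "i (r + 1)" k] r k assms(4,7) by auto
qed

end
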